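(* For any connected hypergraph $H$ with chosen sink $q$, all maximal $H$-parking functions have the same degree.
   Context: A hypergraph $H=(V,E)$ consists of a finite vertex set $V$ and a set $E$ of nonempty subsets of $V$, called hyperedges. $H$ is connected if for any two vertices $v_1,v_2$ there is a sequence of hyperedges $(e_1,\dots,e_m)$ with $v_1\in e_1$, $v_2\in e_m$ and $e_i\cap e_{i+1}\neq\emptyset$ for all $i<m$. One vertex $q\in V$ is fixed as the sink, the others being identified with $[n]=\{1,\dots,n\}$. For nonempty $T\subseteq V$ and $v\in T$, set $\deg_T(v)=|\{e\in E: v\in e \text{ and } e\not\subseteq T\}|$. An $H$-parking function is a vector $\vec{c}\in\mathbb{Z}_{\ge 0}^n$ such that for every nonempty $T\subseteq[n]$ there is $i\in T$ with $c_i<\deg_T(i)$. "Maximal" means maximal for the coordinatewise partial order, and the degree of $\vec{c}$ is $\sum_{i=1}^n c_i$. *)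

theory Defs
  imports Main "HOL-Library.FuncSet"
begin

definition hypergraph :: "'a set \<Rightarrow> 'a set set \<Rightarrow> bool" where
  "hypergraph V E \<longleftrightarrow> finite V \<and> (\<forall>e\<in>E. e \<noteq> {} \<and> e \<subseteq> V)"

definition hyperedge_path :: "'a set set \<Rightarrow> 'a \<Rightarrow> 'a set list \<Rightarrow> 'a \<Rightarrow> bool" where
  "hyperedge_path E v es w \<longleftrightarrow>
     es \<noteq> [] \<and> set es \<subseteq> E \<and> v \<in> hd es \<and> w \<in> last es \<and>
     (\<forall>i. Suc i < length es \<longrightarrow> es ! i \<inter> es ! Suc i \<noteq> {})"

text \<open>Only distinct vertices have to be joined, so a single vertex without hyperedges is
  connected. As soon as there are two vertices, this is the same as also asking for a sequence from
  each vertex to itself.\<close>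

definition connected_hypergraph :: "'a set \<Rightarrow> 'a set set \<Rightarrow> bool" where
  "connected_hypergraph V E \<longleftrightarrow>
     hypergraph V E \<and> (\<forall>v\<in>V. \<forall>w\<in>V. v \<noteq> w \<longrightarrow> (\<exists>es. hyperedge_path E v es w))"

definition deg_in :: "'a set set \<Rightarrow> 'a set \<Rightarrow> 'a \<Rightarrow> nat" where
  "deg_in E T v = card {e \<in> E. v \<in> e \<and> \<not> e \<subseteq> T}"

text \<open>The coordinates of a vector are indexed by the non-sink vertices themselves instead of by
  a numbering \<open>1, \<dots>, n\<close> of them. Vectors are extensional functions, so that equality of
  functions is equality of vectors.\<close>

definition parking_function :: "'a set \<Rightarrow> 'a set set \<Rightarrow> 'a \<Rightarrow> ('a \<Rightarrow> nat) \<Rightarrow> bool" where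
  "parking_function V E q c \<longleftrightarrow>
     c \<in> (V - {q}) \<rightarrow>\<^sub>E UNIV \<and>
     (\<forall>T. T \<noteq> {} \<and> T \<subseteq> V - {q} \<longrightarrow> (\<exists>i\<in>T. c i < deg_in E T i))"

definition maximal_parking_function ::
    "'a set \<Rightarrow> 'a set set \<Rightarrow> 'a \<Rightarrow> ('a \<Rightarrow> nat) \<Rightarrow> bool" where
  "maximal_parking_function V E q c \<longleftrightarrow>
     parking_function V E q c \<and>
     (\<forall>d. parking_function V E q d \<and> (\<forall>i\<in>V - {q}. c i \<le> d i) \<longrightarrow> d = c)"

definition vector_degree :: "'a set \<Rightarrow> 'a \<Rightarrow> ('a \<Rightarrow> nat) \<Rightarrow> nat" where
  "vector_degree V q c = (\<Sum>i\<in>V - {q}. c i)"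

end

theory Submission
  imports Defs
begin

text \<open>
  Start with only the sink burnt and repeatedly burn an unburnt vertex \<open>i\<close> that satisfies the
  parking inequality \<open>c i < deg\<^sub>T i\<close> for the set \<open>T\<close> of currently unburnt vertices; for a parking
  function this never gets stuck. Here \<open>deg\<^sub>T i\<close> counts the hyperedges through \<open>i\<close> that already
  contain a burnt vertex. Raising each \<open>c i\<close> to \<open>deg\<^sub>T i - 1\<close>, with \<open>T\<close> the unburnt set at the moment
  when \<open>i\<close> burns, keeps the same burning order admissible and hence yields a parking function above
  \<open>c\<close>. So a maximal \<open>c\<close> equals it, and its degree plus the number of non-sink vertices is
  the sum of the burning-time degrees \<open>deg\<^sub>T i\<close>. A hyperedge \<open>e\<close> is counted in this
  sum once for each of its vertices except the one that burns first, so the sum is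
  \<open>\<Sum>e\<in>E. (card e - 1)\<close>, which depends neither on the burning order nor on \<open>c\<close>.

  The orderings stay implicit: both the raised vector and the count are obtained by induction on
  the unburnt set.
\<close>

definition parking_on :: "'a set set \<Rightarrow> 'a set \<Rightarrow> ('a \<Rightarrow> nat) \<Rightarrow> bool" where
  "parking_on E T c \<longleftrightarrow> (\<forall>S. S \<noteq> {} \<and> S \<subseteq> T \<longrightarrow> (\<exists>i\<in>S. c i < deg_in E S i))"

text \<open>The number of incidences \<open>i \<in> e\<close> in which \<open>i \<in> T\<close> is not the first vertex of \<open>e\<close> to burn,
  when everything outside \<open>T\<close> burns before \<open>T\<close>.\<close>

definition late_incidences :: "'a set set \<Rightarrow> 'a set \<Rightarrow> nat" where
  "late_incidences E T = (\<Sum>e\<in>E. if e \<subseteq> T then card e - 1 else card (e \<inter> T))"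

lemma deg_in_antimono:
  assumes "finite E" "S \<subseteq> T"
  shows "deg_in E T i \<le> deg_in E S i"
  unfolding deg_in_def by (rule card_mono) (use assms in auto)

text \<open>Burning \<open>i\<close> first among \<open>T\<close> settles exactly the incidences of \<open>i\<close> with hyperedges that
  leave \<open>T\<close>; a hyperedge through \<open>i\<close> inside \<open>T\<close> has \<open>i\<close> as its first vertex.\<close>

lemma late_incidences_remove:
  assumes "finite E" "finite T" "i \<in> T"
  shows "late_incidences E T = late_incidences E (T - {i}) + deg_in E T i"
proof -
  let ?w = "\<lambda>T e. if e \<subseteq> T then card e - 1 else card (e \<inter> T)"
  have edge: "?w T e = ?w (T - {i}) e + (if i \<in> e \<and> \<not> e \<subseteq> T then 1 else 0)" for e
  proof (cases "i \<in> e")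
    case False
    then have "e \<inter> (T - {i}) = e \<inter> T" "e \<subseteq> T - {i} \<longleftrightarrow> e \<subseteq> T" by auto
    with False show ?thesis by simp
  next
    case True
    have "e \<inter> (T - {i}) = e \<inter> T - {i}" by auto
    moreover have "card (e \<inter> T) = Suc (card (e \<inter> T - {i}))"
      using True assms by (intro card.remove) auto
    moreover have "e \<inter> T = e" if "e \<subseteq> T" using that by auto
    ultimately show ?thesis using True by auto
  qed
  have "deg_in E T i = (\<Sum>e\<in>E. if i \<in> e \<and> \<not> e \<subseteq> T then 1 else 0)"
    unfolding deg_in_def using assms(1) by (simp add: sum.If_cases Int_def)
  then show ?thesis
    unfolding late_incidences_def by (subst edge) (simp only: sum.distrib)
qed

text \<open>Burn some \<open>i \<in> T\<close> with \<open>c i < deg\<^sub>T i\<close>, raise its coordinate to \<open>deg\<^sub>T i - 1\<close> and recurse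
  on \<open>T - {i}\<close>. The raised coordinate still witnesses the parking property of every \<open>S \<subseteq> T\<close>
  containing \<open>i\<close>, because shrinking \<open>T\<close> to \<open>S\<close> only increases the degree of \<open>i\<close>.\<close>

lemma parking_on_raise:
  assumes "finite E" "finite T" "parking_on E T c"
  shows "\<exists>d. parking_on E T d \<and> (\<forall>i\<in>T. c i \<le> d i) \<and>
             (\<Sum>i\<in>T. Suc (d i)) = late_incidences E T"
  using assms(2,3)
proof (induction T rule: finite_psubset_induct)
  case (psubset T)
  show ?case
  proof (cases "T = {}")
    case True
    have "late_incidences E {} = 0"
      unfolding late_incidences_def by (rule sum.neutral) auto
    then show ?thesis using True by (auto simp: parking_on_def)
  next
    case False
    then obtain i where i: "i \<in> T" "c i < deg_in E T i"
      using psubset.prems unfolding parking_on_def by blast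
    have "parking_on E (T - {i}) c"
      using psubset.prems unfolding parking_on_def by blast
    then obtain d where d: "parking_on E (T - {i}) d" "\<forall>j\<in>T - {i}. c j \<le> d j"
        "(\<Sum>j\<in>T - {i}. Suc (d j)) = late_incidences E (T - {i})"
      using psubset.IH[of "T - {i}"] i(1) by blast
    let ?d = "d(i := deg_in E T i - 1)"
    have "\<exists>j\<in>S. ?d j < deg_in E S j" if S: "S \<noteq> {}" "S \<subseteq> T" for S
    proof (cases "i \<in> S")
      case True
      have "?d i < deg_in E S i"
        using i(2) deg_in_antimono[OF assms(1) S(2), of i] by simp
      then show ?thesis using True by blast
    next
      case False
      then have "S \<subseteq> T - {i}" using S by auto
      then obtain j where "j \<in> S" "d j < deg_in E S j"
        using d(1) S(1) unfolding parking_on_def by blast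
      with False show ?thesis by (intro bexI[of _ j]) auto
    qed
    then have "parking_on E T ?d" unfolding parking_on_def by blast
    moreover have "\<forall>j\<in>T. c j \<le> ?d j" using d(2) i by auto
    moreover have "(\<Sum>j\<in>T. Suc (?d j)) = late_incidences E T"
    proof -
      have "(\<Sum>j\<in>T. Suc (?d j)) = Suc (?d i) + (\<Sum>j\<in>T - {i}. Suc (?d j))"
        using psubset.hyps i(1) by (rule sum.remove)
      also have "(\<Sum>j\<in>T - {i}. Suc (?d j)) = (\<Sum>j\<in>T - {i}. Suc (d j))"
        by (rule sum.cong) auto
      finally show ?thesis
        using d(3) i late_incidences_remove[OF assms(1) psubset.hyps i(1)] by simp
    qed
    ultimately show ?thesis by blast
  qed
qed

text \<open>By maximality, raising the coordinates changes nothing, so the known coordinate sum of the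
  raised vector is that of \<open>c\<close> itself.\<close>

lemma maximal_parking_function_degree:
  assumes "hypergraph V E" "maximal_parking_function V E q c"
  shows "vector_degree V q c + card (V - {q}) = late_incidences E (V - {q})"
proof -
  let ?T = "V - {q}"
  have fin: "finite V" "finite E"
    using assms(1) finite_subset[of E "Pow V"] unfolding hypergraph_def by auto
  have "parking_on E ?T c"
    using assms(2) unfolding maximal_parking_function_def parking_function_def parking_on_def
    by blast
  then obtain d where d: "parking_on E ?T d" "\<forall>i\<in>?T. c i \<le> d i"
      "(\<Sum>i\<in>?T. Suc (d i)) = late_incidences E ?T"
    using parking_on_raise[of E ?T c] fin by blast
  have "\<exists>i\<in>S. restrict d ?T i < deg_in E S i" if S: "S \<noteq> {}" "S \<subseteq> ?T" for S
  proof -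
    obtain i where "i \<in> S" "d i < deg_in E S i"
      using d(1) S unfolding parking_on_def by blast
    with S(2) show ?thesis by (intro bexI[of _ i]) auto
  qed
  then have "parking_function V E q (restrict d ?T)"
    unfolding parking_function_def by auto
  then have "restrict d ?T = c"
    using assms(2) d(2) unfolding maximal_parking_function_def by simp
  then have "(\<Sum>i\<in>?T. Suc (c i)) = (\<Sum>i\<in>?T. Suc (d i))"
    by (intro sum.cong) auto
  then show ?thesis
    using d(3) by (simp add: vector_degree_def sum_Suc)
qed

theorem corollary3p11:
  fixes V :: "'a set" and E :: "'a set set" and q :: 'a and c d :: "'a \<Rightarrow> nat"
  assumes "connected_hypergraph V E"
    and "q \<in> V"
    and "maximal_parking_function V E q c"
    and "maximal_parking_function V E q d"
  shows "vector_degree V q c = vector_degree V q d"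
proof -
  have "hypergraph V E" using assms(1) unfolding connected_hypergraph_def by blast
  from maximal_parking_function_degree[OF this assms(3)]
    maximal_parking_function_degree[OF this assms(4)]
  show ?thesis by linarith
qed

end
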